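(* $(\mathcal{C}^{N,M},\odot)$ is an Abelian group, where $\odot$ is the Hadamard (entrywise) product; and matrix scaling operations, i.e. the maps $A\mapsto\mathrm{diag}(\boldsymbol{x})\,A$ and $A\mapsto A\,\mathrm{diag}(\boldsymbol{x})$ with $\boldsymbol{x}\in(\mathbb{R}\setminus\{0\})^{MN}$, are permutations in $\mathcal{C}^{N,M}$ (bijections of $\mathcal{C}^{N,M}$ onto itself).
   Context: The set $\mathcal{C}_L^N$ of L-CoLT (lower-collinear triangular) matrices consists of all $B=[b_{i,j}]\in\mathbb{R}^{N\times N}$ with $b_{i,j}=0$ for $i<j$ and $b_{i+1,j}/b_{i,j}=r_i$ for $j\le i$ (with $i\le N-1$), for some vector $\boldsymbol{r}\in(\mathbb{R}\setminus\{0\})^{N-1}$. The set $\mathcal{C}_U^N$ of U-CoLT (upper-collinear triangular) matrices consists of all $B=[b_{i,j}]\in\mathbb{R}^{N\times N}$ with $b_{i,j}=0$ for $i\ge j$ and $b_{i-1,j}/b_{i,j}=r'_{i-1}$ for $i<j$ (with $i\ge2$), for some vector $\boldsymbol{r}'\in(\mathbb{R}\setminus\{0\})^{N-2}$. $\mathcal{C}^N=\{B+B' : B\in\mathcal{C}_L^N,\ B'\in\mathcal{C}_U^N\}$. A matrix $A\in\mathbb{R}^{MN\times MN}$ is partitioned into $M^2$ uniform blocks $A_{i,j}\in\mathbb{R}^{N\times N}$, $1\le i,j\le M$. A vector in $\mathbb{R}^{kN}$ is partitioned into $k$ consecutive blocks of length $N$, the $i$-th block of $\boldsymbol{r}$ being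 $\boldsymbol{r}_i\in\mathbb{R}^N$. $\mathcal{C}^{N,M}$ is the set of $A\in\mathbb{R}^{MN\times MN}$ such that $A_{k,k}\in\mathcal{C}^N$ for all $k$ and there are $\boldsymbol{r}^L,\boldsymbol{r}^U\in(\mathbb{R}\setminus\{0\})^{(M-1)N}$ with $A_{i+1,j}=\mathrm{diag}(\boldsymbol{r}^L_i)A_{i,j}$ for $j\le i$ (with $i\le M-1$) and $A_{i-1,j}=\mathrm{diag}(\boldsymbol{r}^U_{i-1})A_{i,j}$ for $i\le j$ (with $i\ge2$).
   Formalization: The lower triangle of L-CoLT matrices and the strict upper triangle of U-CoLT matrices are required to have nonzero entries; as printed, b_{N,N} and b_{1,2} could be 0, and then the set is not a group (for N=M=1 it would be all of R). *)

theory Defs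
  imports "Jordan_Normal_Form.Matrix"
begin

text \<open>Matrix, vector and block indices are shifted to start at \<open>0\<close>.\<close>

definition nz_vecs :: "nat \<Rightarrow> real vec set" where
  "nz_vecs n = {x \<in> carrier_vec n. \<forall>i<n. x $ i \<noteq> 0}"

definition diag :: "real vec \<Rightarrow> real mat" where
  "diag x = mat_diag (dim_vec x) (\<lambda>i. x $ i)"

definition hadamard :: "real mat \<Rightarrow> real mat \<Rightarrow> real mat" (infixl "\<odot>" 70) where
  "A \<odot> B = mat (dim_row A) (dim_col A) (\<lambda>(i, j). A $$ (i, j) * B $$ (i, j))"

definition ones_mat :: "nat \<Rightarrow> real mat" where
  "ones_mat n = mat n n (\<lambda>_. 1)"

text \<open>
  The entries of the (strict, for the upper case) triangle are required to be nonzero. The ratio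
  conditions force this for every such entry except one corner: the last diagonal entry in the
  lower case and the entry \<open>(0, 1)\<close> in the upper case occur in none of the ratios.
  If these were allowed to vanish, some matrices would
  have no inverse for the Hadamard product.
\<close>

definition L_CoLT :: "nat \<Rightarrow> real mat set" where
  "L_CoLT N = {B \<in> carrier_mat N N.
     (\<forall>i<N. \<forall>j<N. i < j \<longrightarrow> B $$ (i, j) = 0) \<and>
     (\<forall>i<N. \<forall>j\<le>i. B $$ (i, j) \<noteq> 0) \<and>
     (\<exists>r \<in> nz_vecs (N - 1). \<forall>i j. j \<le> i \<and> i + 1 < N \<longrightarrow>
        B $$ (i + 1, j) / B $$ (i, j) = r $ i)}"

text \<open>For \<open>N = 1\<close> the truncated length \<open>N - 2 = 0\<close> makes \<open>U_CoLT\<close> consist of the zero matrix.\<close>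

definition U_CoLT :: "nat \<Rightarrow> real mat set" where
  "U_CoLT N = {B \<in> carrier_mat N N.
     (\<forall>i<N. \<forall>j<N. i \<ge> j \<longrightarrow> B $$ (i, j) = 0) \<and>
     (\<forall>i<N. \<forall>j<N. i < j \<longrightarrow> B $$ (i, j) \<noteq> 0) \<and>
     (\<exists>r \<in> nz_vecs (N - 2). \<forall>i j. 1 \<le> i \<and> i < j \<and> j < N \<longrightarrow>
        B $$ (i - 1, j) / B $$ (i, j) = r $ (i - 1))}"

definition CoLT :: "nat \<Rightarrow> real mat set" where
  "CoLT N = {B + B' | B B'. B \<in> L_CoLT N \<and> B' \<in> U_CoLT N}"

definition mat_block :: "nat \<Rightarrow> real mat \<Rightarrow> nat \<Rightarrow> nat \<Rightarrow> real mat" where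
  "mat_block N A i j = mat N N (\<lambda>(p, q). A $$ (i * N + p, j * N + q))"

definition vec_block :: "nat \<Rightarrow> real vec \<Rightarrow> nat \<Rightarrow> real vec" where
  "vec_block N r i = vec N (\<lambda>p. r $ (i * N + p))"

definition block_CoLT :: "nat \<Rightarrow> nat \<Rightarrow> real mat set" where
  "block_CoLT N M = {A \<in> carrier_mat (M * N) (M * N).
     (\<forall>k<M. mat_block N A k k \<in> CoLT N) \<and>
     (\<exists>rL \<in> nz_vecs ((M - 1) * N). \<exists>rU \<in> nz_vecs ((M - 1) * N).
        (\<forall>i j. j \<le> i \<and> i + 1 < M \<longrightarrow>
           mat_block N A (i + 1) j = diag (vec_block N rL i) * mat_block N A i j) \<and>
        (\<forall>i j. 1 \<le> i \<and> i \<le> j \<and> j < M \<longrightarrow>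
           mat_block N A (i - 1) j = diag (vec_block N rU (i - 1)) * mat_block N A i j))}"

definition hadamard_monoid :: "nat \<Rightarrow> nat \<Rightarrow> real mat monoid" where
  "hadamard_monoid N M =
     \<lparr>carrier = block_CoLT N M, mult = (\<odot>), one = ones_mat (M * N)\<rparr>"

end

theory Submission
  imports Defs
begin

text \<open>
  Each collinearity condition says that, for two fixed rows, the quotient of the entries in a column
  does not depend on the column, as the column ranges over a given set. On matrices without zero
  entries this is the vanishing of certain \<open>2 \<times> 2\<close> minors. An equation
  \<open>a d = b c\<close> between nonzero entries is preserved by entrywise products and inverses,
  and by scaling of rows and columns, whatever the family of minors.
\<close>

definition minor_mats :: "nat \<Rightarrow> (nat \<times> nat \<times> nat \<times> nat) set \<Rightarrow> real mat set" where
  "minor_mats n Q = {A \<in> carrier_mat n n. (\<forall>i<n. \<forall>j<n. A $$ (i, j) \<noteq> 0) \<and>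
     (\<forall>(i, i', j, j') \<in> Q. A $$ (i', j) * A $$ (i, j') = A $$ (i, j) * A $$ (i', j'))}"

lemma minor_matsI:
  assumes "A \<in> carrier_mat n n"
    and "\<And>i j. i < n \<Longrightarrow> j < n \<Longrightarrow> A $$ (i, j) \<noteq> 0"
    and "\<And>i i' j j'. (i, i', j, j') \<in> Q \<Longrightarrow>
      A $$ (i', j) * A $$ (i, j') = A $$ (i, j) * A $$ (i', j')"
  shows "A \<in> minor_mats n Q"
  using assms unfolding minor_mats_def by auto

lemma minor_matsD:
  assumes "A \<in> minor_mats n Q"
  shows "A \<in> carrier_mat n n"
    and "i < n \<Longrightarrow> j < n \<Longrightarrow> A $$ (i, j) \<noteq> 0"
    and "(i, i', j, j') \<in> Q \<Longrightarrow> A $$ (i', j) * A $$ (i, j') = A $$ (i, j) * A $$ (i', j')"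
  using assms unfolding minor_mats_def by auto

lemma index_diag_mult_left:
  assumes "x \<in> carrier_vec n" "A \<in> carrier_mat n m" "i < n" "j < m"
  shows "(diag x * A) $$ (i, j) = x $ i * A $$ (i, j)"
  using assms by (simp add: diag_def mat_diag_mult_left)

lemma index_diag_mult_right:
  assumes "x \<in> carrier_vec n" "A \<in> carrier_mat m n" "i < m" "j < n"
  shows "(A * diag x) $$ (i, j) = A $$ (i, j) * x $ j"
  using assms by (simp add: diag_def mat_diag_mult_right)

lemma diag_carrier: "x \<in> carrier_vec n \<Longrightarrow> diag x \<in> carrier_mat n n"
  by (simp add: diag_def mat_diag_def)

context
  fixes n :: nat and Q :: "(nat \<times> nat \<times> nat \<times> nat) set"
  assumes Q_bounds: "Q \<subseteq> {..<n} \<times> {..<n} \<times> {..<n} \<times> {..<n}"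
begin

lemma minor_index_less:
  assumes "(i, i', j, j') \<in> Q"
  shows "i < n" "i' < n" "j < n" "j' < n"
  using assms Q_bounds by auto

lemma minor_mats_scale:
  assumes A: "A \<in> minor_mats n Q" and C: "C \<in> carrier_mat n n"
    and entries: "\<And>i j. i < n \<Longrightarrow> j < n \<Longrightarrow> C $$ (i, j) = x i * A $$ (i, j) * y j"
    and nz: "\<And>i. i < n \<Longrightarrow> x i \<noteq> 0" "\<And>j. j < n \<Longrightarrow> y j \<noteq> 0"
  shows "C \<in> minor_mats n Q"
proof (rule minor_matsI[OF C])
  show "C $$ (i, j) \<noteq> 0" if "i < n" "j < n" for i j
    using that minor_matsD(2)[OF A that] by (simp add: entries nz)
next
  fix i i' j j' assume q: "(i, i', j, j') \<in> Q"
  have "C $$ (i', j) * C $$ (i, j') = x i * x i' * y j * y j' * (A $$ (i', j) * A $$ (i, j'))"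
    by (simp only: entries minor_index_less[OF q] ac_simps)
  also have "\<dots> = C $$ (i, j) * C $$ (i', j')"
    by (simp only: minor_matsD(3)[OF A q] entries minor_index_less[OF q] ac_simps)
  finally show "C $$ (i', j) * C $$ (i, j') = C $$ (i, j) * C $$ (i', j')" .
qed

lemma minor_mats_hadamard:
  assumes A: "A \<in> minor_mats n Q" and B: "B \<in> minor_mats n Q"
  shows "A \<odot> B \<in> minor_mats n Q"
proof (rule minor_matsI)
  note c = minor_matsD(1)[OF A] minor_matsD(1)[OF B]
  have e: "(A \<odot> B) $$ (i, j) = A $$ (i, j) * B $$ (i, j)" if "i < n" "j < n" for i j
    using c that by (simp add: hadamard_def)
  show "A \<odot> B \<in> carrier_mat n n"
    using c by (simp add: hadamard_def)
  show "(A \<odot> B) $$ (i, j) \<noteq> 0" if "i < n" "j < n" for i j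
    using minor_matsD(2)[OF A that] minor_matsD(2)[OF B that] by (simp add: e that)
  fix i i' j j' assume q: "(i, i', j, j') \<in> Q"
  have "(A \<odot> B) $$ (i', j) * (A \<odot> B) $$ (i, j')
      = (A $$ (i', j) * A $$ (i, j')) * (B $$ (i', j) * B $$ (i, j'))"
    by (simp only: e minor_index_less[OF q] ac_simps)
  also have "\<dots> = (A \<odot> B) $$ (i, j) * (A \<odot> B) $$ (i', j')"
    by (simp only: minor_matsD(3)[OF A q] minor_matsD(3)[OF B q] e minor_index_less[OF q] ac_simps)
  finally show "(A \<odot> B) $$ (i', j) * (A \<odot> B) $$ (i, j') = (A \<odot> B) $$ (i, j) * (A \<odot> B) $$ (i', j')" .
qed

lemma ones_mat_in_minor_mats: "ones_mat n \<in> minor_mats n Q"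
  using minor_index_less by (intro minor_matsI) (auto simp: ones_mat_def)

lemma minor_mats_hadamard_inverse:
  assumes A: "A \<in> minor_mats n Q"
  shows "mat n n (\<lambda>(i, j). inverse (A $$ (i, j))) \<in> minor_mats n Q"
proof (rule minor_matsI)
  fix i i' j j' assume q: "(i, i', j, j') \<in> Q"
  show "mat n n (\<lambda>(i, j). inverse (A $$ (i, j))) $$ (i', j) * mat n n (\<lambda>(i, j). inverse (A $$ (i, j))) $$ (i, j')
    = mat n n (\<lambda>(i, j). inverse (A $$ (i, j))) $$ (i, j) * mat n n (\<lambda>(i, j). inverse (A $$ (i, j))) $$ (i', j')"
    using arg_cong[OF minor_matsD(3)[OF A q], of inverse]
    by (simp add: minor_index_less[OF q])
qed (use minor_matsD(2)[OF A] in auto)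

lemma comm_group_minor_mats:
  "comm_group \<lparr>carrier = minor_mats n Q, mult = (\<odot>), one = ones_mat n\<rparr>"
proof (rule comm_groupI; simp)
  show "A \<odot> B \<in> minor_mats n Q" if "A \<in> minor_mats n Q" "B \<in> minor_mats n Q" for A B
    using that by (rule minor_mats_hadamard)
  show "ones_mat n \<in> minor_mats n Q"
    by (rule ones_mat_in_minor_mats)
  show "A \<odot> B \<odot> C = A \<odot> (B \<odot> C)"
    if "A \<in> minor_mats n Q" "B \<in> minor_mats n Q" "C \<in> minor_mats n Q" for A B C
    using that[THEN minor_matsD(1)] by (intro eq_matI) (auto simp: hadamard_def)
  show "A \<odot> B = B \<odot> A" if "A \<in> minor_mats n Q" "B \<in> minor_mats n Q" for A B
    using that[THEN minor_matsD(1)] by (intro eq_matI) (auto simp: hadamard_def)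
  show "ones_mat n \<odot> A = A" if "A \<in> minor_mats n Q" for A
    using minor_matsD(1)[OF that] by (intro eq_matI) (auto simp: hadamard_def ones_mat_def)
  show "\<exists>B \<in> minor_mats n Q. B \<odot> A = ones_mat n" if "A \<in> minor_mats n Q" for A
    using minor_matsD(1,2)[OF that]
    by (intro bexI[OF _ minor_mats_hadamard_inverse[OF that]] eq_matI)
      (auto simp: hadamard_def ones_mat_def)
qed

lemma bij_betw_minor_mats_row_scaling:
  assumes "x \<in> nz_vecs n"
  shows "bij_betw (\<lambda>A. diag x * A) (minor_mats n Q) (minor_mats n Q)"
proof -
  define y where "y = vec n (\<lambda>i. inverse (x $ i))"
  have x: "x \<in> carrier_vec n" "\<And>i. i < n \<Longrightarrow> x $ i \<noteq> 0"
    and y: "y \<in> carrier_vec n" "\<And>i. i < n \<Longrightarrow> y $ i \<noteq> 0"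
    using assms by (auto simp: nz_vecs_def y_def)
  have closed: "diag z * A \<in> minor_mats n Q"
    if "A \<in> minor_mats n Q" "z \<in> carrier_vec n" "\<And>i. i < n \<Longrightarrow> z $ i \<noteq> 0" for z A
    by (rule minor_mats_scale[where x = "\<lambda>i. z $ i" and y = "\<lambda>_. 1", OF that(1)])
      (use that minor_matsD(1)[OF that(1)] diag_carrier[OF that(2)] in
        \<open>auto simp: index_diag_mult_left[OF that(2)] simp del: index_mult_mat(1)\<close>)
  have cancel: "diag z * (diag w * A) = A"
    if "A \<in> minor_mats n Q" "z \<in> carrier_vec n" "w \<in> carrier_vec n"
      "\<And>i. i < n \<Longrightarrow> z $ i * w $ i = 1" for z w A
  proof (rule eq_matI)
    note A = minor_matsD(1)[OF that(1)]
    note wA = mult_carrier_mat[OF diag_carrier[OF that(3)] A]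
    show "(diag z * (diag w * A)) $$ (i, j) = A $$ (i, j)"
      if "i < dim_row A" "j < dim_col A" for i j
      using that A \<open>\<And>i. i < n \<Longrightarrow> z $ i * w $ i = 1\<close>
      by (simp add: index_diag_mult_left[OF \<open>z \<in> _\<close> wA] index_diag_mult_left[OF \<open>w \<in> _\<close> A]
          flip: mult.assoc)
  qed (use minor_matsD(1)[OF that(1)] diag_carrier[OF that(2)] in auto)
  show ?thesis
    by (rule bij_betw_byWitness[where f' = "\<lambda>A. diag y * A"])
      (use x y in \<open>auto simp: cancel closed y_def\<close>)
qed

lemma bij_betw_minor_mats_col_scaling:
  assumes "x \<in> nz_vecs n"
  shows "bij_betw (\<lambda>A. A * diag x) (minor_mats n Q) (minor_mats n Q)"
proof -
  define y where "y = vec n (\<lambda>i. inverse (x $ i))"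
  have x: "x \<in> carrier_vec n" "\<And>i. i < n \<Longrightarrow> x $ i \<noteq> 0"
    and y: "y \<in> carrier_vec n" "\<And>i. i < n \<Longrightarrow> y $ i \<noteq> 0"
    using assms by (auto simp: nz_vecs_def y_def)
  have closed: "A * diag z \<in> minor_mats n Q"
    if "A \<in> minor_mats n Q" "z \<in> carrier_vec n" "\<And>i. i < n \<Longrightarrow> z $ i \<noteq> 0" for z A
    by (rule minor_mats_scale[where x = "\<lambda>_. 1" and y = "\<lambda>j. z $ j", OF that(1)])
      (use that minor_matsD(1)[OF that(1)] diag_carrier[OF that(2)] in
        \<open>auto simp: index_diag_mult_right[OF that(2)] simp del: index_mult_mat(1)\<close>)
  have cancel: "A * diag w * diag z = A"
    if "A \<in> minor_mats n Q" "z \<in> carrier_vec n" "w \<in> carrier_vec n"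
      "\<And>i. i < n \<Longrightarrow> w $ i * z $ i = 1" for z w A
  proof (rule eq_matI)
    note A = minor_matsD(1)[OF that(1)]
    note Aw = mult_carrier_mat[OF A diag_carrier[OF that(3)]]
    show "(A * diag w * diag z) $$ (i, j) = A $$ (i, j)"
      if "i < dim_row A" "j < dim_col A" for i j
      using that A \<open>\<And>i. i < n \<Longrightarrow> w $ i * z $ i = 1\<close>
      by (simp add: index_diag_mult_right[OF \<open>z \<in> _\<close> Aw] index_diag_mult_right[OF \<open>w \<in> _\<close> A]
          mult.assoc)
  qed (use minor_matsD(1)[OF that(1)] diag_carrier[OF that(2)] in auto)
  show ?thesis
    by (rule bij_betw_byWitness[where f' = "\<lambda>A. A * diag y"])
      (use x y in \<open>auto simp: cancel closed y_def\<close>)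
qed

end

definition CoLT_minors :: "nat \<Rightarrow> (nat \<times> nat \<times> nat \<times> nat) set" where
  "CoLT_minors N = {(p, p + 1, q, 0) | p q. q \<le> p \<and> p + 1 < N} \<union>
     {(p + 1, p, q, N - 1) | p q. p + 1 < q \<and> q < N}"

lemma CoLT_eq_minor_mats: "CoLT N = minor_mats N (CoLT_minors N)"
proof (intro equalityI subsetI)
  fix A assume "A \<in> CoLT N"
  then obtain B B' where A: "A = B + B'" and B: "B \<in> L_CoLT N" and B': "B' \<in> U_CoLT N"
    unfolding CoLT_def by auto
  obtain r where r: "\<And>i j. j \<le> i \<Longrightarrow> i + 1 < N \<Longrightarrow> B $$ (i + 1, j) / B $$ (i, j) = r $ i"
    using B unfolding L_CoLT_def by auto
  obtain s where s: "\<And>i j. 1 \<le> i \<Longrightarrow> i < j \<Longrightarrow> j < N \<Longrightarrow> B' $$ (i - 1, j) / B' $$ (i, j) = s $ (i - 1)"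
    using B' unfolding U_CoLT_def by auto
  have c: "B \<in> carrier_mat N N" "B' \<in> carrier_mat N N"
    using B B' by (auto simp: L_CoLT_def U_CoLT_def)
  have low: "A $$ (i, j) = B $$ (i, j)" "A $$ (i, j) \<noteq> 0" if "j \<le> i" "i < N" for i j
    using that B B' c unfolding A L_CoLT_def U_CoLT_def by auto
  have upp: "A $$ (i, j) = B' $$ (i, j)" "A $$ (i, j) \<noteq> 0" if "i < j" "j < N" for i j
    using that B B' c unfolding A L_CoLT_def U_CoLT_def by auto
  have R: "A $$ (p + 1, q) = r $ p * A $$ (p, q)" if "q \<le> p" "p + 1 < N" for p q
    using r[OF that] low[of q p] low[of q "p + 1"] that by (simp add: field_simps)
  have S: "A $$ (p, q) = s $ p * A $$ (p + 1, q)" if "p + 1 < q" "q < N" for p q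
    using s[of "p + 1" q] upp[of p q] upp[of "p + 1" q] that by (simp add: field_simps)
  show "A \<in> minor_mats N (CoLT_minors N)"
  proof (rule minor_matsI)
    show "A \<in> carrier_mat N N" using c by (simp add: A)
    show "A $$ (i, j) \<noteq> 0" if "i < N" "j < N" for i j
      using that low(2)[of j i] upp(2)[of i j] by (cases "j \<le> i") auto
    fix i i' j j' assume "(i, i', j, j') \<in> CoLT_minors N"
    then consider "i' = i + 1" "j' = 0" "j \<le> i" "i + 1 < N"
      | "i = i' + 1" "j' = N - 1" "i' + 1 < j" "j < N"
      by (auto simp: CoLT_minors_def)
    then show "A $$ (i', j) * A $$ (i, j') = A $$ (i, j) * A $$ (i', j')"
    proof cases
      case 1
      then show ?thesis using R[of j i] R[of 0 i] by simp
    next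
      case 2
      then have "i' + 1 < N - 1" by linarith
      with 2 show ?thesis using S[of i' j] S[of i' "N - 1"] by simp
    qed
  qed
next
  fix A assume A: "A \<in> minor_mats N (CoLT_minors N)"
  note nz = minor_matsD(2)[OF A]
  note c = minor_matsD(1)[OF A]
  define B where "B = mat N N (\<lambda>(i, j). if j \<le> i then A $$ (i, j) else 0)"
  define B' where "B' = mat N N (\<lambda>(i, j). if i < j then A $$ (i, j) else 0)"
  define r where "r = vec (N - 1) (\<lambda>i. A $$ (i + 1, 0) / A $$ (i, 0))"
  define s where "s = vec (N - 2) (\<lambda>i. A $$ (i, N - 1) / A $$ (i + 1, N - 1))"
  have r: "r \<in> nz_vecs (N - 1)"
    unfolding nz_vecs_def r_def using nz by auto
  have s: "s \<in> nz_vecs (N - 2)"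
    unfolding nz_vecs_def s_def using nz by auto
  have "B $$ (i + 1, j) / B $$ (i, j) = r $ i" if "j \<le> i" "i + 1 < N" for i j
  proof -
    have "(i, i + 1, j, 0) \<in> CoLT_minors N" using that by (auto simp: CoLT_minors_def)
    from minor_matsD(3)[OF A this] show ?thesis
      using that nz[of i j] nz[of i 0] by (simp add: B_def r_def field_simps)
  qed
  then have "B \<in> L_CoLT N"
    unfolding L_CoLT_def using r nz by (auto simp: B_def intro!: bexI[of _ r])
  moreover have "B' $$ (i - 1, j) / B' $$ (i, j) = s $ (i - 1)" if "1 \<le> i" "i < j" "j < N" for i j
  proof -
    obtain p where p: "i = p + 1" using \<open>1 \<le> i\<close> by (metis add.commute le_Suc_ex)
    have "(p + 1, p, j, N - 1) \<in> CoLT_minors N" using that p by (auto simp: CoLT_minors_def)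
    from minor_matsD(3)[OF A this] show ?thesis
      using that p nz[of "p + 1" j] nz[of "p + 1" "N - 1"] by (simp add: B'_def s_def field_simps)
  qed
  then have "B' \<in> U_CoLT N"
    unfolding U_CoLT_def using s nz by (auto simp: B'_def intro!: bexI[of _ s])
  moreover have "A = B + B'"
    using c by (intro eq_matI) (auto simp: B_def B'_def)
  ultimately show "A \<in> CoLT N"
    unfolding CoLT_def by blast
qed

definition block_minors :: "nat \<Rightarrow> nat \<Rightarrow> (nat \<times> nat \<times> nat \<times> nat) set" where
  "block_minors N M =
     {(k * N + i, k * N + i', k * N + j, k * N + j') | k i i' j j'.
        k < M \<and> (i, i', j, j') \<in> CoLT_minors N} \<union>
     {(i * N + p, (i + 1) * N + p, j * N + q, 0) | i j p q.
        j \<le> i \<and> i + 1 < M \<and> p < N \<and> q < N} \<union>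
     {((i + 1) * N + p, i * N + p, j * N + q, M * N - 1) | i j p q.
        i + 1 \<le> j \<and> j < M \<and> p < N \<and> q < N}"

lemma CoLT_minors_bounds: "CoLT_minors N \<subseteq> {..<N} \<times> {..<N} \<times> {..<N} \<times> {..<N}"
  by (auto simp: CoLT_minors_def)

lemma block_index_less:
  assumes "i < M" "p < N"
  shows "i * N + p < M * (N :: nat)"
proof -
  have "i * N + p < (i + 1) * N" using assms by simp
  also have "\<dots> \<le> M * N" using assms by (intro mult_right_mono) auto
  finally show ?thesis .
qed

lemma block_minors_bounds:
  "block_minors N M \<subseteq> {..<M * N} \<times> {..<M * N} \<times> {..<M * N} \<times> {..<M * N}"
proof
  fix z assume "z \<in> block_minors N M"
  then consider k i i' j j' where "z = (k * N + i, k * N + i', k * N + j, k * N + j')"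
      "k < M" "(i, i', j, j') \<in> CoLT_minors N"
    | i j p q where "z = (i * N + p, (i + 1) * N + p, j * N + q, 0)"
      "j \<le> i" "i + 1 < M" "p < N" "q < N"
    | i j p q where "z = ((i + 1) * N + p, i * N + p, j * N + q, M * N - 1)"
      "i + 1 \<le> j" "j < M" "p < N" "q < N"
    unfolding block_minors_def by blast
  then show "z \<in> {..<M * N} \<times> {..<M * N} \<times> {..<M * N} \<times> {..<M * N}"
  proof cases
    case 1
    then show ?thesis using CoLT_minors_bounds[of N] by (auto intro!: block_index_less)
  next
    case 2
    then show ?thesis
      using block_index_less[of i M p N] block_index_less[of "i + 1" M p N]
        block_index_less[of j M q N] by simp
  next
    case 3
    then show ?thesis
      using block_index_less[of i M p N] block_index_less[of "i + 1" M p N]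
        block_index_less[of j M q N] by simp
  qed
qed

lemma mat_block_eq_diag_iff:
  "mat_block N A i j = diag (vec_block N r l) * mat_block N A i' j' \<longleftrightarrow>
     (\<forall>p<N. \<forall>q<N. A $$ (i * N + p, j * N + q) = r $ (l * N + p) * A $$ (i' * N + p, j' * N + q))"
proof -
  have c: "vec_block N r l \<in> carrier_vec N" "mat_block N A i' j' \<in> carrier_mat N N"
    by (simp_all add: vec_block_def mat_block_def)
  have d: "dim_row (diag (vec_block N r l)) = N"
    using diag_carrier[OF c(1)] by auto
  show ?thesis
    unfolding mat_eq_iff using c
    by (simp add: index_diag_mult_left[OF c] d del: index_mult_mat(1))
      (simp add: mat_block_def vec_block_def)
qed

lemma block_CoLTE:
  assumes "A \<in> block_CoLT N M"
  obtains rL rU where "rL \<in> nz_vecs ((M - 1) * N)" "rU \<in> nz_vecs ((M - 1) * N)"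
    and "\<And>i j p q. j \<le> i \<Longrightarrow> i + 1 < M \<Longrightarrow> p < N \<Longrightarrow> q < N \<Longrightarrow>
      A $$ ((i + 1) * N + p, j * N + q) = rL $ (i * N + p) * A $$ (i * N + p, j * N + q)"
    and "\<And>i j p q. i + 1 \<le> j \<Longrightarrow> j < M \<Longrightarrow> p < N \<Longrightarrow> q < N \<Longrightarrow>
      A $$ (i * N + p, j * N + q) = rU $ (i * N + p) * A $$ ((i + 1) * N + p, j * N + q)"
proof -
  obtain rL rU where nz: "rL \<in> nz_vecs ((M - 1) * N)" "rU \<in> nz_vecs ((M - 1) * N)"
    and L: "\<forall>i j. j \<le> i \<and> i + 1 < M \<longrightarrow>
      mat_block N A (i + 1) j = diag (vec_block N rL i) * mat_block N A i j"
    and U: "\<forall>i j. 1 \<le> i \<and> i \<le> j \<and> j < M \<longrightarrow>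
      mat_block N A (i - 1) j = diag (vec_block N rU (i - 1)) * mat_block N A i j"
    using assms unfolding block_CoLT_def by blast
  show thesis
  proof (rule that[OF nz])
    fix i j p q :: nat
    assume pq: "p < N" "q < N"
    show "A $$ ((i + 1) * N + p, j * N + q) = rL $ (i * N + p) * A $$ (i * N + p, j * N + q)"
      if "j \<le> i" "i + 1 < M"
      using that pq L[rule_format, of j i, unfolded mat_block_eq_diag_iff] by blast
    show "A $$ (i * N + p, j * N + q) = rU $ (i * N + p) * A $$ ((i + 1) * N + p, j * N + q)"
      if "i + 1 \<le> j" "j < M"
      using that pq U[rule_format, of "i + 1" j, unfolded mat_block_eq_diag_iff] by simp
  qed
qed

lemma block_CoLT_entries_nonzero:
  assumes A: "A \<in> block_CoLT N M" and "i < M" "j < M" "p < N" "q < N"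
  shows "A $$ (i * N + p, j * N + q) \<noteq> 0"
proof -
  obtain rL rU where nz: "rL \<in> nz_vecs ((M - 1) * N)" "rU \<in> nz_vecs ((M - 1) * N)"
    and L: "\<And>i j p q. j \<le> i \<Longrightarrow> i + 1 < M \<Longrightarrow> p < N \<Longrightarrow> q < N \<Longrightarrow>
      A $$ ((i + 1) * N + p, j * N + q) = rL $ (i * N + p) * A $$ (i * N + p, j * N + q)"
    and U: "\<And>i j p q. i + 1 \<le> j \<Longrightarrow> j < M \<Longrightarrow> p < N \<Longrightarrow> q < N \<Longrightarrow>
      A $$ (i * N + p, j * N + q) = rU $ (i * N + p) * A $$ ((i + 1) * N + p, j * N + q)"
    using block_CoLTE[OF A] by metis
  have r: "rL $ (i * N + p) \<noteq> 0" "rU $ (i * N + p) \<noteq> 0" if "i + 1 < M" for i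
    using nz block_index_less[of i "M - 1" p N] that \<open>p < N\<close> unfolding nz_vecs_def by auto
  have diag: "A $$ (j * N + p, j * N + q) \<noteq> 0"
  proof -
    have "mat_block N A j j \<in> CoLT N" using A \<open>j < M\<close> by (auto simp: block_CoLT_def)
    from minor_matsD(2)[OF this[unfolded CoLT_eq_minor_mats] \<open>p < N\<close> \<open>q < N\<close>]
    show ?thesis using assms by (simp add: mat_block_def)
  qed
  show ?thesis
  proof (cases "j \<le> i")
    case True
    then show ?thesis using \<open>i < M\<close>
    proof (induction i rule: dec_induct)
      case (step i)
      then show ?case using L[of j i p q] r[of i] assms by simp
    qed (use diag in simp)
  next
    case False
    then have "i \<le> j" by simp
    then show ?thesis
    proof (induction i rule: inc_induct)
      case (step i)
      then show ?case using U[of i j p q] r[of i] assms by simp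
    qed (use diag in simp)
  qed
qed

lemma mat_block_in_CoLT_iff:
  assumes nz: "\<And>p q. p < N \<Longrightarrow> q < N \<Longrightarrow> A $$ (k * N + p, k * N + q) \<noteq> 0"
  shows "mat_block N A k k \<in> CoLT N \<longleftrightarrow> (\<forall>(i, i', j, j') \<in> CoLT_minors N.
    A $$ (k * N + i', k * N + j) * A $$ (k * N + i, k * N + j') =
    A $$ (k * N + i, k * N + j) * A $$ (k * N + i', k * N + j'))"
proof -
  have e: "mat_block N A k k $$ (p, q) = A $$ (k * N + p, k * N + q)" if "p < N" "q < N" for p q
    using that by (simp add: mat_block_def)
  have "mat_block N A k k \<in> carrier_mat N N"
    by (simp add: mat_block_def)
  moreover have "\<forall>p<N. \<forall>q<N. mat_block N A k k $$ (p, q) \<noteq> 0"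
    using nz by (simp add: e)
  moreover have "(\<forall>(i, i', j, j') \<in> CoLT_minors N.
      mat_block N A k k $$ (i', j) * mat_block N A k k $$ (i, j') =
      mat_block N A k k $$ (i, j) * mat_block N A k k $$ (i', j')) \<longleftrightarrow>
    (\<forall>(i, i', j, j') \<in> CoLT_minors N.
      A $$ (k * N + i', k * N + j) * A $$ (k * N + i, k * N + j') =
      A $$ (k * N + i, k * N + j) * A $$ (k * N + i', k * N + j'))"
    using CoLT_minors_bounds[of N] by (intro ball_cong refl) (auto simp: e)
  ultimately show ?thesis
    unfolding CoLT_eq_minor_mats minor_mats_def by simp
qed

lemma block_CoLT_eq_minor_mats:
  assumes "N \<ge> 1" "M \<ge> 1"
  shows "block_CoLT N M = minor_mats (M * N) (block_minors N M)"
proof (intro equalityI subsetI)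
  have last: "M * N - 1 = (M - 1) * N + (N - 1)"
    using assms by (cases M; cases N) auto
  fix A assume A: "A \<in> block_CoLT N M"
  note nz = block_CoLT_entries_nonzero[OF A]
  obtain rL rU where L: "\<And>i j p q. j \<le> i \<Longrightarrow> i + 1 < M \<Longrightarrow> p < N \<Longrightarrow> q < N \<Longrightarrow>
      A $$ ((i + 1) * N + p, j * N + q) = rL $ (i * N + p) * A $$ (i * N + p, j * N + q)"
    and U: "\<And>i j p q. i + 1 \<le> j \<Longrightarrow> j < M \<Longrightarrow> p < N \<Longrightarrow> q < N \<Longrightarrow>
      A $$ (i * N + p, j * N + q) = rU $ (i * N + p) * A $$ ((i + 1) * N + p, j * N + q)"
    using block_CoLTE[OF A] by metis
  show "A \<in> minor_mats (M * N) (block_minors N M)"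
  proof (rule minor_matsI)
    show "A \<in> carrier_mat (M * N) (M * N)" using A by (simp add: block_CoLT_def)
    show "A $$ (i, j) \<noteq> 0" if "i < M * N" "j < M * N" for i j
      using nz[of "i div N" "j div N" "i mod N" "j mod N"] that assms
      by (simp add: less_mult_imp_div_less)
    fix a a' b b' assume "(a, a', b, b') \<in> block_minors N M"
    then consider k i i' j j' where "a = k * N + i" "a' = k * N + i'" "b = k * N + j"
        "b' = k * N + j'" "k < M" "(i, i', j, j') \<in> CoLT_minors N"
      | i j p q where "a = i * N + p" "a' = (i + 1) * N + p" "b = j * N + q" "b' = 0"
        "j \<le> i" "i + 1 < M" "p < N" "q < N"
      | i j p q where "a = (i + 1) * N + p" "a' = i * N + p" "b = j * N + q" "b' = M * N - 1"
        "i + 1 \<le> j" "j < M" "p < N" "q < N"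
      unfolding block_minors_def by blast
    then show "A $$ (a', b) * A $$ (a, b') = A $$ (a, b) * A $$ (a', b')"
    proof cases
      case 1
      then have "mat_block N A k k \<in> CoLT N" using A by (auto simp: block_CoLT_def)
      then show ?thesis using 1 nz by (subst (asm) mat_block_in_CoLT_iff) auto
    next
      case 2
      then show ?thesis using L[of j i p q] L[of 0 i p 0] assms by simp
    next
      case 3
      then have "i + 1 \<le> M - 1" by linarith
      then show ?thesis
        using 3 U[of i j p q] U[of i "M - 1" p "N - 1"] assms
        unfolding last by simp
    qed
  qed
next
  fix A assume A: "A \<in> minor_mats (M * N) (block_minors N M)"
  note nz = minor_matsD(2)[OF A]
  define rL where "rL = vec ((M - 1) * N) (\<lambda>s. A $$ (s + N, 0) / A $$ (s, 0))"
  define rU where "rU = vec ((M - 1) * N) (\<lambda>s. A $$ (s, M * N - 1) / A $$ (s + N, M * N - 1))"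
  have shift: "s < M * N" "s + N < M * N" if "s < (M - 1) * N" for s
    using that assms by (cases M; simp)+
  have pos: "0 < M * N" "M * N - 1 < M * N" using assms by auto
  have "rL \<in> nz_vecs ((M - 1) * N)" "rU \<in> nz_vecs ((M - 1) * N)"
    unfolding nz_vecs_def rL_def rU_def using nz shift pos by auto
  moreover have "A $$ ((i + 1) * N + p, j * N + q) = rL $ (i * N + p) * A $$ (i * N + p, j * N + q)"
    if "j \<le> i" "i + 1 < M" "p < N" "q < N" for i j p q
  proof -
    have s: "i * N + p < (M - 1) * N" using that by (intro block_index_less) auto
    have "(i * N + p, (i + 1) * N + p, j * N + q, 0) \<in> block_minors N M"
      unfolding block_minors_def using that by blast
    from minor_matsD(3)[OF A this] show ?thesis
      using s shift[OF s] nz[OF shift(1)[OF s] pos(1)] by (simp add: rL_def field_simps)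
  qed
  moreover have "A $$ ((i - 1) * N + p, j * N + q) =
      rU $ ((i - 1) * N + p) * A $$ (i * N + p, j * N + q)"
    if "1 \<le> i" "i \<le> j" "j < M" "p < N" "q < N" for i j p q
  proof -
    obtain l where l: "i = l + 1" using \<open>1 \<le> i\<close> by (metis add.commute le_Suc_ex)
    have s: "l * N + p < (M - 1) * N" using that l by (intro block_index_less) auto
    have "((l + 1) * N + p, l * N + p, j * N + q, M * N - 1) \<in> block_minors N M"
      unfolding block_minors_def using that l by blast
    from minor_matsD(3)[OF A this] show ?thesis
      using l s shift[OF s] nz[OF shift(2)[OF s] pos(2)] by (simp add: rU_def field_simps)
  qed
  moreover have "mat_block N A k k \<in> CoLT N" if "k < M" for k
  proof (subst mat_block_in_CoLT_iff)
    show "A $$ (k * N + p, k * N + q) \<noteq> 0" if "p < N" "q < N" for p q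
      using that \<open>k < M\<close> by (intro nz block_index_less)
    have "(k * N + i, k * N + i', k * N + j, k * N + j') \<in> block_minors N M"
      if "(i, i', j, j') \<in> CoLT_minors N" for i i' j j'
      unfolding block_minors_def using that \<open>k < M\<close> by blast
    from minor_matsD(3)[OF A this]
    show "\<forall>(i, i', j, j') \<in> CoLT_minors N.
      A $$ (k * N + i', k * N + j) * A $$ (k * N + i, k * N + j') =
      A $$ (k * N + i, k * N + j) * A $$ (k * N + i', k * N + j')"
      by auto
  qed
  ultimately show "A \<in> block_CoLT N M"
    unfolding block_CoLT_def mat_block_eq_diag_iff using minor_matsD(1)[OF A]
    by (intro CollectI conjI bexI[of _ rL] bexI[of _ rU]) simp_all
qed

theorem theorem5p2:
  fixes N M :: nat
  assumes "N \<ge> 1" and "M \<ge> 1"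
  shows "comm_group (hadamard_monoid N M) \<and>
    (\<forall>x \<in> nz_vecs (M * N).
       bij_betw (\<lambda>A. diag x * A) (block_CoLT N M) (block_CoLT N M) \<and>
       bij_betw (\<lambda>A. A * diag x) (block_CoLT N M) (block_CoLT N M))"
  unfolding hadamard_monoid_def block_CoLT_eq_minor_mats[OF assms]
  using comm_group_minor_mats[OF block_minors_bounds]
    bij_betw_minor_mats_row_scaling[OF block_minors_bounds]
    bij_betw_minor_mats_col_scaling[OF block_minors_bounds]
  by blast

end
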